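(* Let $b$ be a prime, $m,s\in\mathbb{N}$, let $C^{(1)},\ldots,C^{(s)}\in\mathbb{F}_b^{m\times m}$, let $\boldsymbol{w}=(w_j)_{j=1}^s$ be integers with $0=w_1\le w_2\le\cdots\le w_s$, and let $s^*\in\{1,\ldots,s\}$ be the largest index such that $w_{s^*}<m$. Let $\widehat P_m$ be the reduced digital net with generating matrices $\widehat C^{(1)},\ldots,\widehat C^{(s)}$ obtained from the $C^{(j)}$ and $\boldsymbol{w}$, and assume that $\widehat C^{(1)},\ldots,\widehat C^{(s)}$ are the generating matrices of a digital $((t_{\mathfrak{u}})_{\mathfrak{u}\subseteq[s]},m,s)$-net. Furthermore assume product weights $\gamma_{\mathfrak{u}}=\prod_{j\in\mathfrak{u}}\gamma_j$ with $\gamma_1\ge\gamma_2\ge\cdots>0$. Then $$D^*_{b^m,\boldsymbol{\gamma}}(\widehat P_m)\le\max_{\emptyset\ne\mathfrak{u}\subseteq[s]}\Big[\frac{1}{b^m}\prod_{j\in\mathfrak{u}}\gamma_j(1+b^{w_j})\Big]$$ $$\qquad+\max_{\emptyset\ne\mathfrak{v}\subseteq[s^*]}\Bigg[\gamma_{\mathfrak{v}}\sum_{\emptyset\ne\mathfrak{p}\subseteq\mathfrak{v}}\frac{b^{t_{\mathfrak{p}}}}{b^m}\Bigg[\frac1b\Big(\frac{b^2+b}{3}\Big)^{|\mathfrak{p}|}\max\Big(\frac{(m-t_{\mathfrak{p}})^{|\mathfrak{p}|-1}}{(|\mathfrak{p}|-1)!},\frac1b\Big)+\Big(\frac{b^2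-1}{3b}\Big)^{|\mathfrak{p}|}\prod_{j\in\mathfrak{p}}(m-w_j)\Bigg]\Bigg].$$
   Context: $[s]=\{1,\ldots,s\}$. $\mathbb{F}_b$ is identified with $\{0,1,\ldots,b-1\}$. For an integer $0\le n<b^m$, $\vec n\in\mathbb{F}_b^m$ denotes its vector of $b$-adic digits, least significant first. Reduced digital net. Given $C^{(j)}=(C^{(j)}_{p,q})_{p,q=1}^m$ and $w_j$, the matrix $\widehat C^{(j)}$ is obtained from $C^{(j)}$ by setting its last $\min(w_j,m)$ rows to zero: $\widehat C^{(j)}_{p,q}=C^{(j)}_{p,q}$ if $1\le p\le m-\min(w_j,m)$, and $\widehat C^{(j)}_{p,q}=0$ otherwise. The reduced digital net is the family (counted with multiplicity) of $b^m$ points $\widehat P_m=\{\boldsymbol{z}_0,\ldots,\boldsymbol{z}_{b^m-1}\}$, $\boldsymbol{z}_n=(z_{1,n},\ldots,z_{s,n})\in[0,1)^s$, where $z_{j,n}=\sum_{i=1}^m(\widehat C^{(j)}\vec n)_i\,b^{-i}$. Nets. A $(t,m,d)$-net in base $b$ (integers $0\le t\le m$) is a family of $b^m$ points in $[0,1)^d$, counted with multiplicity, such that every interval $\prod_{j=1}^d[a_jb^{-d_j},(a_j+1)b^{-d_j})$ with integers $d_j\ge0$, $0\le a_j<b^{d_j}$, of volume $b^{t-m}$ contains exactly $b^t$ of the points. The matrices $\widehat C^{(1)},\dots,\widehat C^{(s)}$ generate a digital $((t_{\mathfrak{u}})_{\mathfrak{u}\subseteq[s]},m,s)$-net if for every $\emptyset\ne\mathfrak{u}\subseteq[s]$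 the projection of $\widehat P_m$ onto the coordinates in $\mathfrak{u}$ is a $(t_{\mathfrak{u}},m,|\mathfrak{u}|)$-net in base $b$. Weighted star discrepancy. For a family $P_m$ of $b^m$ points in $[0,1)^s$ (counted with multiplicity) and positive weights $\boldsymbol{\gamma}=(\gamma_{\mathfrak{u}})$, $$D^*_{b^m,\boldsymbol{\gamma}}(P_m)=\sup_{\boldsymbol{x}\in(0,1]^s}\max_{\emptyset\ne\mathfrak{u}\subseteq[s]}\gamma_{\mathfrak{u}}|\Delta_{P_m,\mathfrak{u}}(\boldsymbol{x})|,\quad \Delta_{P_m,\mathfrak{u}}(\boldsymbol{x})=\frac{\#\{(y_1,\ldots,y_s)\in P_m:y_j<x_j\ \forall j\in\mathfrak{u}\}}{b^m}-\prod_{j\in\mathfrak{u}}x_j.$$ The convention $0^0=1$ is used. *)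

theory Defs
  imports Complex_Main "HOL-Library.FuncSet" "HOL-Computational_Algebra.Primes"
    "Jordan_Normal_Form.Matrix"
begin

text \<open>
  The prime field with \<open>b\<close> elements is identified with \<open>{0, ..., b - 1}\<close>: its elements are natural
  numbers below \<open>b\<close>, and results of arithmetic operations are reduced modulo \<open>b\<close>. Coordinates of
  points are numbered from 1, whereas rows and columns of matrices are numbered from 0, as usual for
  \<^typ>\<open>'a mat\<close>.
\<close>

definition Fb_mats :: "nat \<Rightarrow> nat \<Rightarrow> nat mat set" where
  "Fb_mats b m = {A \<in> carrier_mat m m. elements_mat A \<subseteq> {0..<b}}"

definition digit_vec :: "nat \<Rightarrow> nat \<Rightarrow> nat \<Rightarrow> nat vec" where
  "digit_vec b m n = vec m (\<lambda>i. n div b ^ i mod b)"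

text \<open>
  A family of \<open>b ^ m\<close> points (counted with multiplicity) is a function \<open>P\<close>, where \<open>P n j\<close> is the
  \<open>j\<close>-th coordinate of the \<open>n\<close>-th point, \<open>n < b ^ m\<close>.
\<close>

definition digital_points :: "nat \<Rightarrow> nat \<Rightarrow> (nat \<Rightarrow> nat mat) \<Rightarrow> nat \<Rightarrow> nat \<Rightarrow> real" where
  "digital_points b m C n j =
     (\<Sum>i<m. real ((C j *\<^sub>v digit_vec b m n) $ i mod b) / real b ^ (i + 1))"

definition reduced_mat :: "nat \<Rightarrow> nat \<Rightarrow> nat mat \<Rightarrow> nat mat" where
  "reduced_mat m w A = mat m m (\<lambda>(p, q). if p < m - min w m then A $$ (p, q) else 0)"

text \<open>
  The projection of \<open>P\<close> onto the coordinates in \<open>u\<close> is a \<open>(t, m, |u|)\<close>-net in base \<open>b\<close>. The axes of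
  the \<open>|u|\<close>-dimensional unit cube are labelled by the elements of \<open>u\<close>.
\<close>

definition is_net :: "nat \<Rightarrow> nat \<Rightarrow> nat \<Rightarrow> nat set \<Rightarrow> (nat \<Rightarrow> nat \<Rightarrow> real) \<Rightarrow> bool" where
  "is_net b t m u P \<longleftrightarrow>
     t \<le> m \<and>
     (\<forall>n<b ^ m. \<forall>j\<in>u. P n j \<in> {0..<1}) \<and>
     (\<forall>(d :: nat \<Rightarrow> nat) (a :: nat \<Rightarrow> nat).
        (\<forall>j\<in>u. a j < b ^ d j) \<and>
        (\<Prod>j\<in>u. 1 / real b ^ d j) = real b powi (int t - int m) \<longrightarrow>
        card {n. n < b ^ m \<and>
                 (\<forall>j\<in>u. P n j \<in> {real (a j) / real b ^ d j ..< (real (a j) + 1) / real b ^ d j})}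
          = b ^ t)"

definition generates_digital_net ::
    "nat \<Rightarrow> (nat set \<Rightarrow> nat) \<Rightarrow> nat \<Rightarrow> nat \<Rightarrow> (nat \<Rightarrow> nat mat) \<Rightarrow> bool" where
  "generates_digital_net b t m s C \<longleftrightarrow>
     (\<forall>u. u \<noteq> {} \<and> u \<subseteq> {1..s} \<longrightarrow> is_net b (t u) m u (digital_points b m C))"

definition local_discr ::
    "nat \<Rightarrow> nat \<Rightarrow> (nat \<Rightarrow> nat \<Rightarrow> real) \<Rightarrow> nat set \<Rightarrow> (nat \<Rightarrow> real) \<Rightarrow> real" where
  "local_discr b m P u x =
     real (card {n. n < b ^ m \<and> (\<forall>j\<in>u. P n j < x j)}) / real b ^ m - (\<Prod>j\<in>u. x j)"

definition weighted_star_discr ::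
    "nat \<Rightarrow> nat \<Rightarrow> nat \<Rightarrow> (nat set \<Rightarrow> real) \<Rightarrow> (nat \<Rightarrow> nat \<Rightarrow> real) \<Rightarrow> real" where
  "weighted_star_discr b m s \<gamma> P =
     (SUP x \<in> {1..s} \<rightarrow>\<^sub>E {0<..1}.
        Max ((\<lambda>u. \<gamma> u * \<bar>local_discr b m P u x\<bar>) ` {u. u \<noteq> {} \<and> u \<subseteq> {1..s}}))"

definition product_weights :: "(nat \<Rightarrow> real) \<Rightarrow> nat set \<Rightarrow> real" where
  "product_weights \<gamma> u = (\<Prod>j\<in>u. \<gamma> j)"

end

theory Submission imports Defs begin

text \<open>
  A set of coordinates containing some \<open>j\<close> with \<open>w\<^sub>j \<ge> m\<close> contributes at most its weight, which the
  first maximum already dominates. For the others the net property alone suffices: writing \<open>[0, x\<^sub>j)\<close>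
  as a union of at most \<open>b - 1\<close> elementary intervals of each length \<open>b\<^sup>-\<^sup>1, b\<^sup>-\<^sup>2, \<dots>\<close> and a remainder,
  the points over each such interval form a smaller net in the remaining coordinates. Induction on
  the dimension \<open>d\<close> bounds the discrepancy by \<open>b ^ t * (\<Sum>i<d. (b - 1) ^ i * (m - t choose i))\<close>
  points, and this is at most the single term with \<open>p = v = u\<close> in the second maximum.
\<close>

section \<open>Elementary intervals and families equidistributed over elementary boxes\<close>

definition elem_interval :: "nat \<Rightarrow> nat \<Rightarrow> nat \<Rightarrow> real set" where
  "elem_interval b d a = {real a / real b ^ d ..< (real a + 1) / real b ^ d}"

text \<open>
  A \<open>(t, m, |u|)\<close>-net corresponds to \<open>T = b ^ t\<close> and \<open>k = m - t\<close>; including the larger elementary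
  boxes makes the property pass to subfamilies over an elementary interval.
\<close>
definition box_net ::
    "nat \<Rightarrow> nat \<Rightarrow> nat \<Rightarrow> 'j set \<Rightarrow> 'i set \<Rightarrow> ('i \<Rightarrow> 'j \<Rightarrow> real) \<Rightarrow> bool" where
  "box_net b T k u S P \<longleftrightarrow>
     finite S \<and> (\<forall>n\<in>S. \<forall>j\<in>u. P n j \<in> {0..<1}) \<and>
     (\<forall>d a. (\<forall>j\<in>u. a j < b ^ d j) \<and> sum d u \<le> k \<longrightarrow>
        card {n \<in> S. \<forall>j\<in>u. P n j \<in> elem_interval b (d j) (a j)} = T * b ^ (k - sum d u))"

lemma elem_interval_0 [simp]: "elem_interval b 0 0 = {0..<1}"
  by (simp add: elem_interval_def)

lemma elem_interval_iff_floor: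
  assumes "b > 0"
  shows "y \<in> elem_interval b d a \<longleftrightarrow> \<lfloor>y * real b ^ d\<rfloor> = int a"
  using assms by (auto simp: elem_interval_def floor_eq_iff field_simps)

lemma elem_interval_split:
  assumes "b > 0"
  shows "elem_interval b d a = (\<Union>r<b. elem_interval b (Suc d) (b * a + r))"
proof (intro subset_antisym subsetI)
  fix y assume y: "y \<in> elem_interval b d a"
  \<comment> \<open>\<open>f\<close> lies among the \<open>b\<close> consecutive integers from
    \<open>b * a\<close> on; its offset from \<open>b * a\<close> is the next base-\<open>b\<close>
    digit of \<open>y\<close> and selects the subinterval.\<close>
  define f where "f = \<lfloor>y * real b ^ Suc d\<rfloor>"
  have lo: "real a \<le> y * real b ^ d" and hi: "y * real b ^ d < real a + 1"
    using y assms by (auto simp: elem_interval_def field_simps)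
  have "real b * real a \<le> y * real b ^ Suc d"
    using mult_left_mono[OF lo, of "real b"] by (simp add: algebra_simps)
  then have 1: "int (b * a) \<le> f"
    unfolding f_def by (simp add: le_floor_iff)
  have "y * real b ^ Suc d < real b * (real a + 1)"
    using mult_strict_left_mono[OF hi, of "real b"] assms by (simp add: algebra_simps)
  then have 2: "f < int (b * a + b)"
    unfolding f_def by (simp add: floor_less_iff algebra_simps)
  define r where "r = nat (f - int (b * a))"
  have "r < b" "f = int (b * a + r)" using 1 2 by (auto simp: r_def)
  then show "y \<in> (\<Union>r<b. elem_interval b (Suc d) (b * a + r))"
    using assms by (auto simp: elem_interval_iff_floor f_def)
next
  fix y assume "y \<in> (\<Union>r<b. elem_interval b (Suc d) (b * a + r))"
  then obtain r where r: "r < b" and y: "y \<in> elem_interval b (Suc d) (b * a + r)" by auto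
  have "real (b * a + r) \<le> y * real b ^ Suc d" "y * real b ^ Suc d < real (b * a + r) + 1"
    using y assms by (auto simp: elem_interval_def field_simps simp del: power_Suc)
  moreover have "y * real b ^ Suc d = real b * (y * real b ^ d)"
    "real (b * a + r) = real b * real a + real r" "real b * (real a + 1) = real b * real a + real b"
    by (simp_all add: distrib_left)
  moreover have "real r + 1 \<le> real b" using r by linarith
  ultimately have "real b * real a \<le> real b * (y * real b ^ d)"
    "real b * (y * real b ^ d) < real b * (real a + 1)"
    by linarith+
  then have "real a \<le> y * real b ^ d" "y * real b ^ d < real a + 1"
    using assms by simp_all
  then show "y \<in> elem_interval b d a"
    using assms by (simp add: elem_interval_def field_simps)
qed

lemma elem_interval_disjoint:
  assumes "b > 0" "a \<noteq> a'"
  shows "elem_interval b d a \<inter> elem_interval b d a' = {}"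
  using assms by (auto simp: elem_interval_iff_floor)

text \<open>A box with \<open>sum d u < k\<close> is cut along one fixed axis \<open>i\<close> into
  \<open>b\<close> disjoint boxes of order one higher, so its count is \<open>b\<close> times
  theirs. Induction on the number \<open>l\<close> of missing refinements starts from the boxes of
  order exactly \<open>k\<close>.\<close>

lemma box_net_of_finest:
  assumes b: "b > 0" and u: "finite u" "u \<noteq> {}" and S: "finite S"
    and P: "\<forall>n\<in>S. \<forall>j\<in>u. P n j \<in> {0..<1}"
    and finest: "\<And>d a. \<forall>j\<in>u. a j < b ^ d j \<Longrightarrow> sum d u = k \<Longrightarrow>
        card {n \<in> S. \<forall>j\<in>u. P n j \<in> elem_interval b (d j) (a j)} = T"
  shows "box_net b T k u S P"
proof -
  obtain i where i: "i \<in> u" using u by auto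
  have "card {n \<in> S. \<forall>j\<in>u. P n j \<in> elem_interval b (d j) (a j)} = T * b ^ l"
    if "\<forall>j\<in>u. a j < b ^ d j" "sum d u + l = k" for d a l
    using that
  proof (induction l arbitrary: d a)
    case 0
    then show ?case using finest by simp
  next
    case (Suc l)
    \<comment> \<open>\<open>A r\<close> collects the points in the \<open>r\<close>-th of the
      \<open>b\<close> boxes obtained by refining axis \<open>i\<close> once.\<close>
    define A where "A r = {n \<in> S. \<forall>j\<in>u. P n j \<in>
      elem_interval b ((d(i := Suc (d i))) j) ((a(i := b * a i + r)) j)}" for r
    have ai: "b * a i + r < b * b ^ d i" if "r < b" for r
    proof -
      have "a i + 1 \<le> b ^ d i" using Suc.prems i by (simp add: Suc_leI)
      then have "b * (a i + 1) \<le> b * b ^ d i" by (rule mult_le_mono2)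
      then show ?thesis using that by simp
    qed
    have sum: "sum (d(i := Suc (d i))) u + l = k"
      using Suc.prems sum.remove[OF u(1) i, of d] sum.remove[OF u(1) i, of "d(i := Suc (d i))"]
      by simp
    have cardA: "card (A r) = T * b ^ l" if "r < b" for r
      unfolding A_def by (rule Suc.IH) (use Suc.prems ai[OF that] sum in auto)
    have "{n \<in> S. \<forall>j\<in>u. P n j \<in> elem_interval b (d j) (a j)} = (\<Union>r<b. A r)"
    proof -
      have *: "(\<forall>j\<in>u. P n j \<in> elem_interval b (d j) (a j)) \<longleftrightarrow>
          (\<exists>r<b. P n i \<in> elem_interval b (Suc (d i)) (b * a i + r)) \<and>
          (\<forall>j\<in>u - {i}. P n j \<in> elem_interval b (d j) (a j))" for n
        using i elem_interval_split[OF b, of "d i" "a i"] by blast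
      have **: "n \<in> A r \<longleftrightarrow> n \<in> S \<and> P n i \<in> elem_interval b (Suc (d i)) (b * a i + r) \<and>
          (\<forall>j\<in>u - {i}. P n j \<in> elem_interval b (d j) (a j))" for n and r :: nat
        using i unfolding A_def by auto
      show ?thesis
        by (rule Set.set_eqI) (unfold mem_Collect_eq UN_iff * **, blast)
    qed
    also have "card \<dots> = (\<Sum>r<b. card (A r))"
    proof (rule card_UN_disjoint)
      show "\<forall>r\<in>{..<b}. \<forall>r'\<in>{..<b}. r \<noteq> r' \<longrightarrow> A r \<inter> A r' = {}"
      proof (intro ballI impI)
        fix r r' :: nat assume "r \<noteq> r'"
        then have "elem_interval b (Suc (d i)) (b * a i + r) \<inter>
            elem_interval b (Suc (d i)) (b * a i + r') = {}"
          using b by (intro elem_interval_disjoint) auto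
        then show "A r \<inter> A r' = {}"
          using i unfolding A_def by fastforce
      qed
    qed (use S in \<open>auto simp: A_def\<close>)
    also have "\<dots> = T * b ^ Suc l" using cardA by simp
    finally show ?case .
  qed
  then show ?thesis using S P unfolding box_net_def by simp
qed

text \<open>This drives the induction on the dimension: restricting coordinate \<open>i\<close> to
  an interval of length b^(-h) uses up \<open>h\<close> of the \<open>k\<close> available
  refinements and leaves \<open>T\<close> unchanged. A box for \<open>u\<close> is extended by that
  interval on axis \<open>i\<close>.\<close>

lemma box_net_slice:
  assumes net: "box_net b T k (insert i u) S P" and "finite u" "i \<notin> u"
    and a: "a < b ^ h" and h: "h \<le> k"
  shows "box_net b T (k - h) u {n \<in> S. P n i \<in> elem_interval b h a} P"
  unfolding box_net_def
proof (intro conjI allI impI)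
  fix d c assume *: "(\<forall>j\<in>u. c j < b ^ d j) \<and> sum d u \<le> k - h"
  have **: "sum (d(i := h)) (insert i u) = h + sum d u"
    using assms by (simp, intro sum.cong, auto)
  have "card {n \<in> S. \<forall>j\<in>insert i u. P n j \<in> elem_interval b ((d(i := h)) j) ((c(i := a)) j)}
      = T * b ^ (k - sum (d(i := h)) (insert i u))"
  proof -
    have "\<forall>j\<in>insert i u. (c(i := a)) j < b ^ (d(i := h)) j" using * a by simp
    moreover have "sum (d(i := h)) (insert i u) \<le> k" using * h unfolding ** by linarith
    ultimately show ?thesis using net unfolding box_net_def by blast
  qed
  also have "{n \<in> S. \<forall>j\<in>insert i u. P n j \<in> elem_interval b ((d(i := h)) j) ((c(i := a)) j)}
      = {n \<in> {n \<in> S. P n i \<in> elem_interval b h a}. \<forall>j\<in>u. P n j \<in> elem_interval b (d j) (c j)}"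
    using assms by auto
  finally show "card {n \<in> {n \<in> S. P n i \<in> elem_interval b h a}.
      \<forall>j\<in>u. P n j \<in> elem_interval b (d j) (c j)} = T * b ^ (k - h - sum d u)"
    unfolding ** by simp
qed (use net in \<open>auto simp: box_net_def\<close>)

lemma box_net_drop:
  assumes "box_net b T k (insert i u) S P" and "finite u" "i \<notin> u"
  shows "box_net b T k u S P"
proof -
  have "{n \<in> S. P n i \<in> elem_interval b 0 0} = S"
    using assms(1) by (auto simp: box_net_def)
  then show ?thesis using box_net_slice[OF assms, of 0 0] by simp
qed

section \<open>The discrepancy bound and its recursion\<close>

text \<open>Closed form of the solution of the recursion in \<open>net_bound_Suc\<close>, with value
  0 for \<open>d = 0\<close>.\<close>

definition net_bound :: "nat \<Rightarrow> nat \<Rightarrow> nat \<Rightarrow> real" where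
  "net_bound b k d = (\<Sum>i<d. (real b - 1) ^ i * real (k choose i))"

text \<open>The right-hand side mirrors one step of the induction on the dimension: 1 for the
  remainder, and \<open>b - 1\<close> slices at each level, whose nets have parameter
  \<open>h < k\<close>. The hockey-stick identity evaluates the sum over \<open>h\<close>.\<close>

lemma net_bound_Suc:
  "net_bound b k (Suc d) = 1 + (real b - 1) * (\<Sum>h<k. net_bound b h d)"
proof -
  have hockey: "(\<Sum>h<k. h choose i) = k choose Suc i" for i
    by (induction k) auto
  have "(\<Sum>h<k. net_bound b h d) = (\<Sum>i<d. \<Sum>h<k. (real b - 1) ^ i * real (h choose i))"
    unfolding net_bound_def by (rule sum.swap)
  also have "\<dots> = (\<Sum>i<d. (real b - 1) ^ i * real (k choose Suc i))"
    by (simp flip: sum_distrib_left of_nat_sum add: hockey)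
  finally show ?thesis
    by (simp add: net_bound_def sum.lessThan_Suc_shift sum_distrib_left mult.assoc
        del: sum.lessThan_Suc)
qed

lemma net_bound_mono:
  assumes "b \<ge> 1"
  shows "net_bound b k d \<le> net_bound b k (Suc d)"
  using assms by (simp add: net_bound_def)

section \<open>Discrepancy of box nets by induction on the dimension\<close>

text \<open>Unnormalised local discrepancy. The total mass \<open>N\<close> is a parameter because
  the slices in the induction have different sizes.\<close>

definition count_err :: "'i set \<Rightarrow> ('i \<Rightarrow> 'j \<Rightarrow> real) \<Rightarrow> 'j set \<Rightarrow> ('j \<Rightarrow> real) \<Rightarrow> real \<Rightarrow> real" where
  "count_err S P u x N = real (card {n \<in> S. \<forall>j\<in>u. P n j < x j}) - N * prod x u"

text \<open>The threshold in the new coordinate is approached along its base-\<open>b\<close>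
  digits. Each elementary interval passed on the way is a slice to which the induction hypothesis
  applies, hence \<open>S\<close> and \<open>k\<close> are generalised.\<close>

lemma box_net_discrepancy:
  assumes "finite u" and b: "b \<ge> 1" and "box_net b T k u S P"
    and "\<forall>j\<in>u. 0 < x j \<and> x j \<le> 1"
  shows "\<bar>count_err S P u x (real T * real b ^ k)\<bar> \<le> real T * net_bound b k (card u)"
  using assms(1,3,4)
proof (induction u arbitrary: S k rule: finite_induct)
  case empty
  then have "card S = T * b ^ k"
    unfolding box_net_def by auto
  then show ?case by (simp add: count_err_def net_bound_def)
next
  case (insert i u)
  note net = insert.prems(1)
  have finS: "finite S" and P: "\<And>n. n \<in> S \<Longrightarrow> 0 \<le> P n i \<and> P n i < 1"
    using net by (auto simp: box_net_def)
  have xi: "0 < x i" "x i \<le> 1" and xu: "\<forall>j\<in>u. 0 < x j \<and> x j \<le> 1" using insert.prems by auto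
  have pi: "0 \<le> prod x u" "prod x u \<le> 1"
    using xu by (auto intro!: prod_nonneg prod_le_1 simp: less_imp_le)
  have cardu: "card (insert i u) = Suc (card u)" using insert.hyps by simp
  show ?case
  \<comment> \<open>For \<open>x i = 1\<close> the digit argument would need
    \<open>a = b ^ k\<close>, which numbers no interval in the unit interval. The constraint on
    coordinate \<open>i\<close> is vacuous then, so the coordinate is dropped.\<close>
  proof (cases "x i = 1")
    case True
    have "{n \<in> S. \<forall>j\<in>insert i u. P n j < x j} = {n \<in> S. \<forall>j\<in>u. P n j < x j}"
      using P True by auto
    then have "count_err S P (insert i u) x N = count_err S P u x N" for N
      using insert.hyps True by (simp add: count_err_def)
    then have "\<bar>count_err S P (insert i u) x (real T * real b ^ k)\<bar> \<le> real T * net_bound b k (card u)"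
      using insert.IH[OF box_net_drop[OF net insert.hyps] xu] by simp
    also have "\<dots> \<le> real T * net_bound b k (card (insert i u))"
      unfolding cardu by (intro mult_left_mono net_bound_mono b) auto
    finally show ?thesis .
  next
    case False
    define Q where "Q = {n \<in> S. \<forall>j\<in>u. P n j < x j}"
    have finQ: "finite Q" using finS by (simp add: Q_def)
    have slice: "\<bar>real (card {n \<in> Q. P n i \<in> elem_interval b h a}) - real T * real b ^ (k - h) * prod x u\<bar>
        \<le> real T * net_bound b (k - h) (card u)" if "a < b ^ h" "h \<le> k" for h a
    proof -
      have "{n \<in> Q. P n i \<in> elem_interval b h a} =
          {n \<in> {n \<in> S. P n i \<in> elem_interval b h a}. \<forall>j\<in>u. P n j < x j}"
        by (auto simp: Q_def)
      then show ?thesis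
        using insert.IH[OF box_net_slice[OF net insert.hyps that] xu]
        by (simp add: count_err_def)
    qed
    \<comment> \<open>The error as a function of the threshold in coordinate \<open>i\<close> alone:
      \<open>F (x i)\<close> is the quantity to bound, and the increment of \<open>F\<close> over an
      elementary interval is the error of a slice.\<close>
    define F where "F y = real (card {n \<in> Q. P n i < y}) - real T * real b ^ k * (y * prod x u)" for y
    have step: "\<bar>F ((real a + 1) / real b ^ h) - F (real a / real b ^ h)\<bar>
        \<le> real T * net_bound b (k - h) (card u)" if "a < b ^ h" "h \<le> k" for a h
    proof -
      have le: "real a / real b ^ h \<le> (real a + 1) / real b ^ h"
        by (simp add: divide_right_mono)
      have "{n \<in> Q. P n i < (real a + 1) / real b ^ h} =
          {n \<in> Q. P n i < real a / real b ^ h} \<union> {n \<in> Q. P n i \<in> elem_interval b h a}"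
        using le by (auto simp: elem_interval_def)
      moreover have "{n \<in> Q. P n i < real a / real b ^ h} \<inter>
          {n \<in> Q. P n i \<in> elem_interval b h a} = {}"
        by (auto simp: elem_interval_def)
      ultimately have "card {n \<in> Q. P n i < (real a + 1) / real b ^ h} =
          card {n \<in> Q. P n i < real a / real b ^ h} + card {n \<in> Q. P n i \<in> elem_interval b h a}"
        using finQ by (simp add: card_Un_disjoint)
      moreover have "real b ^ k / real b ^ h = real b ^ (k - h)"
        using that b by (simp add: power_diff)
      then have "real b ^ k * ((real a + 1) / real b ^ h) =
          real b ^ k * (real a / real b ^ h) + real b ^ (k - h)"
        by (simp add: add_divide_distrib algebra_simps)
      then have "real T * real b ^ k * ((real a + 1) / real b ^ h * prod x u) =
          real T * real b ^ k * (real a / real b ^ h * prod x u) + real T * real b ^ (k - h) * prod x u"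
        by (metis (no_types, opaque_lifting) distrib_left distrib_right mult.assoc)
      ultimately show ?thesis
        using slice[OF that] unfolding F_def by simp
    qed
    \<comment> \<open>Starting from \<open>F 0 = 0\<close>, the digit at level \<open>g + 1\<close>
      costs at most \<open>b - 1\<close> increments over intervals of length b^(-(g+1)).\<close>
    have digits: "\<bar>F (real a / real b ^ h)\<bar>
        \<le> real T * ((real b - 1) * (\<Sum>g<h. net_bound b (k - Suc g) (card u)))"
      if "a < b ^ h" "h \<le> k" for a h
      using that
    proof (induction h arbitrary: a)
      case 0
      then have "{n \<in> Q. P n i < 0} = {}" using P by (force simp: Q_def)
      then have "F 0 = 0" by (simp only: F_def) simp
      then show ?case using 0 by simp
    next
      case (Suc h)
      define c where "c = a div b"
      have c: "c < b ^ h" using Suc.prems by (simp add: c_def less_mult_imp_div_less mult.commute)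
      have nb: "0 \<le> net_bound b (k - Suc h) (card u)"
        using b by (auto simp: net_bound_def intro!: sum_nonneg)
      \<comment> \<open>\<open>c\<close> is \<open>a\<close> without its last digit, and c/b^h =
        (b*c)/b^(h+1). From there \<open>a mod b\<close> unit steps at level \<open>Suc h\<close>
        lead to \<open>a\<close>.\<close>
      have ind: "\<bar>F (real (b * c + r) / real b ^ Suc h) - F (real (b * c) / real b ^ Suc h)\<bar>
          \<le> real r * (real T * net_bound b (k - Suc h) (card u))" if "b * c + r \<le> a" for r
        using that
      proof (induction r)
        case (Suc r)
        have "\<bar>F ((real (b * c + r) + 1) / real b ^ Suc h) - F (real (b * c + r) / real b ^ Suc h)\<bar>
            \<le> real T * net_bound b (k - Suc h) (card u)" (is "_ \<le> ?K")
          using Suc.prems \<open>a < b ^ Suc h\<close> \<open>Suc h \<le> k\<close> by (intro step) auto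
        moreover have "real (b * c + r) + 1 = real (b * c + Suc r)" by simp
        moreover have "real (Suc r) * ?K = real r * ?K + ?K" by (simp add: distrib_right)
        moreover have "\<bar>F (real (b * c + r) / real b ^ Suc h) - F (real (b * c) / real b ^ Suc h)\<bar>
            \<le> real r * ?K"
          using Suc by simp
        ultimately show ?case by (simp only:) linarith
      qed simp
      have r: "real (a mod b) \<le> real b - 1"
      proof -
        have "a mod b < b" using b by simp
        then show ?thesis by linarith
      qed
      have "real (b * c) / real b ^ Suc h = real c / real b ^ h" using b by simp
      moreover have "b * c + a mod b = a" by (simp add: c_def)
      ultimately have "\<bar>F (real a / real b ^ Suc h) - F (real c / real b ^ h)\<bar>
          \<le> real (a mod b) * (real T * net_bound b (k - Suc h) (card u))"
        using ind[of "a mod b"] by simp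
      also have "\<dots> \<le> (real b - 1) * (real T * net_bound b (k - Suc h) (card u))"
        using r nb by (intro mult_right_mono) auto
      finally show ?case using Suc.IH[OF c] Suc.prems by (simp add: algebra_simps)
    qed
    \<comment> \<open>The base-\<open>b\<close> digits of \<open>a\<close> are the first
      \<open>k\<close> digits of \<open>x i\<close> after the point.\<close>
    define a where "a = nat \<lfloor>x i * real b ^ k\<rfloor>"
    have a: "int a = \<lfloor>x i * real b ^ k\<rfloor>" using xi by (simp add: a_def)
    have xI: "x i \<in> elem_interval b k a" using a b by (simp add: elem_interval_iff_floor)
    have "x i * real b ^ k < 1 * real b ^ k"
      using xi False b by (intro mult_strict_right_mono) auto
    then have ak: "a < b ^ k"
      using a by (metis floor_less_iff mult_1 of_int_of_nat_eq of_nat_less_iff of_nat_power)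
    \<comment> \<open>The remainder lies in one interval of length b^(-k), whose slice has exactly
      \<open>T\<close> points. Both the actual count \<open>card R\<close> and the expected count
      are between 0 and \<open>T\<close>, so they differ by at most \<open>T\<close>.\<close>
    have resid: "\<bar>F (x i) - F (real a / real b ^ k)\<bar> \<le> real T"
    proof -
      have lo: "real a / real b ^ k \<le> x i" and hi: "x i < (real a + 1) / real b ^ k"
        using xI by (auto simp: elem_interval_def)
      define R where "R = {n \<in> Q. real a / real b ^ k \<le> P n i \<and> P n i < x i}"
      have "{n \<in> Q. P n i < x i} = {n \<in> Q. P n i < real a / real b ^ k} \<union> R"
        using lo by (auto simp: R_def)
      moreover have "{n \<in> Q. P n i < real a / real b ^ k} \<inter> R = {}" "finite R"
        using finQ by (auto simp: R_def)
      ultimately have 1: "card {n \<in> Q. P n i < x i} =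
          card {n \<in> Q. P n i < real a / real b ^ k} + card R"
        using finQ by (simp add: card_Un_disjoint)
      have "box_net b T 0 u {n \<in> S. P n i \<in> elem_interval b k a} P"
        using box_net_slice[OF net insert.hyps ak] by simp
      \<comment> \<open>With all \<open>d j = 0\<close> the box is the whole cube, so the net
        property with parameter 0 counts the full slice.\<close>
      then have "card {n \<in> {n \<in> S. P n i \<in> elem_interval b k a}.
          \<forall>j\<in>u. P n j \<in> elem_interval b 0 0} = T" (is "card ?Z = T")
        unfolding box_net_def by (auto dest!: spec[of _ "\<lambda>_. 0"])
      moreover have "R \<subseteq> ?Z"
        using hi net by (auto simp: R_def Q_def elem_interval_def box_net_def)
      then have "card R \<le> card ?Z" using finS by (intro card_mono) auto
      ultimately have 2: "card R \<le> T" by simp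
      \<comment> \<open>The fractional part of \<open>x i * real b ^ k\<close>, that is, the
        relative position of \<open>x i\<close> in its interval.\<close>
      define \<delta> where "\<delta> = real b ^ k * (x i - real a / real b ^ k)"
      have \<delta>: "0 \<le> \<delta>" "\<delta> \<le> 1"
        using a xi b by (simp_all add: \<delta>_def right_diff_distrib mult.commute[of _ "x i"])
          (linarith+)
      have "F (x i) - F (real a / real b ^ k) = real (card R) - real T * (\<delta> * prod x u)"
        using 1 by (simp add: F_def \<delta>_def algebra_simps)
      moreover have "0 \<le> \<delta> * prod x u" "\<delta> * prod x u \<le> 1" using \<delta> pi by (auto intro: mult_le_one)
      then have "0 \<le> real T * (\<delta> * prod x u)" "real T * (\<delta> * prod x u) \<le> real T"
        by (auto intro: mult_left_le)
      ultimately show ?thesis using 2 by linarith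
    qed
    have "{n \<in> S. \<forall>j\<in>insert i u. P n j < x j} = {n \<in> Q. P n i < x i}" by (auto simp: Q_def)
    then have "count_err S P (insert i u) x (real T * real b ^ k) = F (x i)"
      using insert.hyps by (simp add: count_err_def F_def)
    also have "\<bar>\<dots>\<bar> \<le> real T * ((real b - 1) * (\<Sum>g<k. net_bound b (k - Suc g) (card u))) + real T"
      using digits[OF ak] resid by linarith
    \<comment> \<open>Reversing the order of the levels, h = k - 1 - g, gives the sum in
      \<open>net_bound_Suc\<close>.\<close>
    also have "\<dots> = real T * net_bound b k (card (insert i u))"
      unfolding cardu net_bound_Suc sum.nat_diff_reindex[of "\<lambda>h. net_bound b h (card u)"]
      by (simp add: algebra_simps)
    finally show ?thesis .
  qed
qed

section \<open>Comparison with the closed expression in the theorem\<close>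

text \<open>Put n = d - 1 and A = (b^2 + b)/3. Since b >= 2 gives b <= A, one has b^n <= A^d / b. If
  n <= k, the binomial theorem bounds the sum by b^n k^n / n!. If n > k, the sum is the complete
  expansion of b^k <= b^(n-1), which accounts for the alternative 1/b in the maximum.\<close>

lemma net_bound_le:
  assumes b: "b \<ge> 2" and d: "d \<ge> 1"
  shows "net_bound b k d \<le> 1 / real b * ((real b ^ 2 + real b) / 3) ^ d
    * max (real k ^ (d - 1) / fact (d - 1)) (1 / real b)"
proof -
  obtain n where n: "d = Suc n" using d by (cases d) auto
  define A where "A = (real b ^ 2 + real b) / 3"
  have "real b * 3 \<le> real b * (real b + 1)" using b by (intro mult_left_mono) auto
  then have A: "real b \<le> A" by (simp add: A_def power2_eq_square algebra_simps)
  have "real b * real b ^ n \<le> A ^ d"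
    using power_mono[OF A, of d] n by simp
  then have Ad: "real b ^ n \<le> 1 / real b * A ^ d" using b by (simp add: field_simps)
  have "net_bound b k d \<le> 1 / real b * A ^ d * max (real k ^ n / fact n) (1 / real b)"
  proof (cases "n \<le> k")
    case True
    have "(real b - 1) ^ i * real (k choose i) \<le> real k ^ n / fact n * (real (n choose i) * (real b - 1) ^ i)"
      if "i \<le> n" for i
    proof -
      have "real (k choose i) \<le> real k ^ i / fact i"
        using binomial_fact_pow[of k i] by (simp add: field_simps) (metis of_nat_fact of_nat_le_iff of_nat_mult of_nat_power)
      \<comment> \<open>After cancelling factorials this says (n-i)! <= k^(n-i), which follows from
        (n-i)! <= (n-i)^(n-i) and n - i <= k.\<close>
      also have "\<dots> \<le> real k ^ n / fact n * real (n choose i)"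
      proof -
        have "fact (n - i) \<le> (n - i) ^ (n - i)" using fact_le_power[of "n - i", where 'a = nat] by simp
        also have "\<dots> \<le> k ^ (n - i)" using True by (intro power_mono) auto
        finally have "real (fact (n - i)) \<le> real (k ^ (n - i))" by (simp only: of_nat_le_iff)
        then have "real k ^ i * fact (n - i) \<le> real k ^ i * real k ^ (n - i)"
          by (intro mult_left_mono) auto
        also have "\<dots> = real k ^ n" using that by (simp flip: power_add)
        finally show ?thesis using that by (simp add: binomial_fact field_simps)
      qed
      finally have "(real b - 1) ^ i * real (k choose i) \<le>
          (real b - 1) ^ i * (real k ^ n / fact n * real (n choose i))"
        using b by (intro mult_left_mono) auto
      then show ?thesis by (simp only: mult_ac)
    qed
    then have "net_bound b k d \<le> (\<Sum>i\<le>n. real k ^ n / fact n * (real (n choose i) * (real b - 1) ^ i))"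
      unfolding net_bound_def n lessThan_Suc_atMost by (intro sum_mono) auto
    also have "\<dots> = real k ^ n / fact n * real b ^ n"
      using binomial_ring[of "real b - 1" 1 n] by (simp add: sum_distrib_left)
    also have "\<dots> \<le> max (real k ^ n / fact n) (1 / real b) * (1 / real b * A ^ d)"
      using Ad A by (intro mult_mono) (auto simp: le_max_iff_disj)
    finally show ?thesis by (simp add: mult.commute)
  next
    case False
    then have "net_bound b k d = (\<Sum>i\<le>k. (real b - 1) ^ i * real (k choose i))"
      unfolding net_bound_def n by (intro sum.mono_neutral_right) auto
    also have "\<dots> = real b ^ k"
      using binomial_ring[of "real b - 1" 1 k] by (simp add: mult.commute)
    also have "\<dots> \<le> real b ^ (n - 1)" using False b by (intro power_increasing) auto
    also have "\<dots> = real b ^ n * (1 / real b)" using False b by (simp add: power_diff)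
    also have "\<dots> \<le> 1 / real b * A ^ d * max (real k ^ n / fact n) (1 / real b)"
      using Ad A by (intro mult_mono) auto
    finally show ?thesis .
  qed
  then show ?thesis by (simp add: n A_def)
qed

section \<open>Local discrepancy of nets\<close>

text \<open>Volume b^(t-m) means \<open>sum d u = m - t\<close>, so \<open>is_net\<close> prescribes
  exactly the counts of the finest boxes.\<close>

lemma is_net_box_net:
  assumes b: "b > 0" and u: "finite u" "u \<noteq> {}" and net: "is_net b t m u P"
  shows "box_net b (b ^ t) (m - t) u {..<b ^ m} P"
proof (rule box_net_of_finest)
  fix d a assume a: "\<forall>j\<in>u. a j < b ^ d j" and d: "sum d u = m - t"
  have tm: "t \<le> m" using net by (simp add: is_net_def)
  have "(\<Prod>j\<in>u. 1 / real b ^ d j) = 1 / real b ^ (m - t)"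
    by (simp only: prod_dividef prod.neutral_const power_sum[symmetric] d)
  also have "\<dots> = real b powi (- int (m - t))"
    by (simp only: power_int_minus power_int_of_nat inverse_eq_divide)
  also have "- int (m - t) = int t - int m" using tm by simp
  finally show "card {n \<in> {..<b ^ m}. \<forall>j\<in>u. P n j \<in> elem_interval b (d j) (a j)} = b ^ t"
    using net a unfolding is_net_def elem_interval_def by simp
qed (use assms in \<open>auto simp: is_net_def\<close>)

lemma local_discr_net_bound:
  assumes b: "b \<ge> 2" and u: "finite u" "u \<noteq> {}" and net: "is_net b t m u P"
    and x: "\<forall>j\<in>u. 0 < x j \<and> x j \<le> 1"
  shows "\<bar>local_discr b m P u x\<bar> \<le> real b ^ t / real b ^ m *
    (1 / real b * ((real b ^ 2 + real b) / 3) ^ card u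
       * max ((real m - real t) ^ (card u - 1) / fact (card u - 1)) (1 / real b))" (is "_ \<le> _ * ?B")
proof -
  have tm: "t \<le> m" using net by (simp add: is_net_def)
  have "\<bar>count_err {..<b ^ m} P u x (real (b ^ t) * real b ^ (m - t))\<bar>
      \<le> real (b ^ t) * net_bound b (m - t) (card u)"
    using b by (intro box_net_discrepancy is_net_box_net u net x) auto
  also have "real (b ^ t) * real b ^ (m - t) = real b ^ m"
    using tm by (simp flip: power_add)
  also have "count_err {..<b ^ m} P u x (real b ^ m) = real b ^ m * local_discr b m P u x"
    using b by (simp add: count_err_def local_discr_def algebra_simps)
  also have "net_bound b (m - t) (card u) \<le> ?B"
    using net_bound_le[OF b, of "card u" "m - t"] u tm by (simp add: of_nat_diff card_gt_0_iff Suc_le_eq)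
  finally show ?thesis using b by (simp add: abs_mult field_simps mult_left_mono)
qed

text \<open>Both terms of the difference lie in [0, 1]. This trivial bound serves the coordinate
  sets containing some \<open>j\<close> with \<open>w j\<close> at least \<open>m\<close>.\<close>

lemma abs_local_discr_le_1:
  assumes "b > 0" and x: "\<forall>j\<in>u. 0 < x j \<and> x j \<le> 1"
  shows "\<bar>local_discr b m P u x\<bar> \<le> 1"
proof -
  have "card {n. n < b ^ m \<and> (\<forall>j\<in>u. P n j < x j)} \<le> card {..<b ^ m}"
    by (intro card_mono) auto
  then have "real (card {n. n < b ^ m \<and> (\<forall>j\<in>u. P n j < x j)}) \<le> real (b ^ m)"
    by (simp only: of_nat_le_iff card_lessThan)
  then have "real (card {n. n < b ^ m \<and> (\<forall>j\<in>u. P n j < x j)}) / real b ^ m \<le> 1"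
    using assms by simp
  moreover have "0 \<le> prod x u" "prod x u \<le> 1"
    using x by (auto intro!: prod_nonneg prod_le_1 simp: less_imp_le)
  ultimately show ?thesis unfolding local_discr_def
    by (smt (verit) divide_nonneg_nonneg of_nat_0_le_iff zero_le_power)
qed

section \<open>The weighted star discrepancy of the reduced net\<close>

theorem theorem4:
  fixes b m s s' :: nat
    and C Chat :: "nat \<Rightarrow> nat mat"
    and w :: "nat \<Rightarrow> nat"
    and t :: "nat set \<Rightarrow> nat"
    and \<gamma> :: "nat \<Rightarrow> real"
  assumes "prime b" and "m \<ge> 1" and "s \<ge> 1"
    and "\<forall>j\<in>{1..s}. C j \<in> Fb_mats b m"
    and "w 1 = 0" and "\<forall>i\<in>{1..s}. \<forall>j\<in>{1..s}. i \<le> j \<longrightarrow> w i \<le> w j"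
    and "s' = Max {j \<in> {1..s}. w j < m}"
    and "\<forall>j\<in>{1..s}. Chat j = reduced_mat m (w j) (C j)"
    and "generates_digital_net b t m s Chat"
    and "\<forall>i\<in>{1..s}. \<forall>j\<in>{1..s}. i \<le> j \<longrightarrow> \<gamma> j \<le> \<gamma> i"
    and "\<forall>j\<in>{1..s}. \<gamma> j > 0"
  shows "weighted_star_discr b m s (product_weights \<gamma>) (digital_points b m Chat) \<le>
      Max ((\<lambda>u. 1 / real b ^ m * (\<Prod>j\<in>u. \<gamma> j * (1 + real b ^ w j)))
             ` {u. u \<noteq> {} \<and> u \<subseteq> {1..s}})
    + Max ((\<lambda>v. product_weights \<gamma> v *
               (\<Sum>p | p \<noteq> {} \<and> p \<subseteq> v.
                  real b ^ t p / real b ^ m *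
                  (1 / real b * ((real b ^ 2 + real b) / 3) ^ card p
                     * max ((real m - real (t p)) ^ (card p - 1) / fact (card p - 1)) (1 / real b)
                   + ((real b ^ 2 - 1) / (3 * real b)) ^ card p
                     * (\<Prod>j\<in>p. real m - real (w j)))))
             ` {v. v \<noteq> {} \<and> v \<subseteq> {1..s'}})"
proof -
  let ?F = "\<lambda>u. 1 / real b ^ m * (\<Prod>j\<in>u. \<gamma> j * (1 + real b ^ w j))"
  \<comment> \<open>\<open>?H\<close> is the part of the summand that comes from
    \<open>local_discr_net_bound\<close>; \<open>?T\<close> is the whole summand.\<close>
  let ?H = "\<lambda>p. 1 / real b * ((real b ^ 2 + real b) / 3) ^ card p
                     * max ((real m - real (t p)) ^ (card p - 1) / fact (card p - 1)) (1 / real b)"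
  let ?T = "\<lambda>p. real b ^ t p / real b ^ m *
                  (?H p + ((real b ^ 2 - 1) / (3 * real b)) ^ card p * (\<Prod>j\<in>p. real m - real (w j)))"
  let ?G = "\<lambda>v. product_weights \<gamma> v * (\<Sum>p | p \<noteq> {} \<and> p \<subseteq> v. ?T p)"
  let ?U = "{u. u \<noteq> {} \<and> u \<subseteq> {1..s}}" and ?V = "{v. v \<noteq> {} \<and> v \<subseteq> {1..s'}}"
  have b: "b \<ge> 2" using assms(1) by (rule prime_ge_2_nat)
  have finU: "finite (f ` ?U)" "finite (g ` ?V)" for f g :: "nat set \<Rightarrow> real"
    by (auto intro!: finite_imageI)
  let ?J = "{j \<in> {1..s}. w j < m}"
  have J: "1 \<in> ?J" using assms(2,3,5) by auto
  then have s'J: "s' \<in> ?J" using Max_in[of ?J] unfolding assms(7) by fastforce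
  \<comment> \<open>As \<open>w\<close> is monotone, the indices with \<open>w j < m\<close> form
    the initial segment ending at \<open>s'\<close>.\<close>
  have V_iff: "j \<le> s' \<longleftrightarrow> w j < m" if "j \<in> {1..s}" for j
  proof
    assume "j \<le> s'"
    then have "w j \<le> w s'" using assms(6) s'J that by auto
    then show "w j < m" using s'J by auto
  next
    assume "w j < m"
    then show "j \<le> s'" using that unfolding assms(7) by (intro Max_ge) auto
  qed
  have T_nonneg: "0 \<le> ?T p" "0 \<le> ((real b ^ 2 - 1) / (3 * real b)) ^ card p * (\<Prod>j\<in>p. real m - real (w j))"
    if "p \<subseteq> {1..s'}" for p
  proof -
    have "real (w j) \<le> real m" if "j \<in> p" for j
      using V_iff[of j] \<open>p \<subseteq> {1..s'}\<close> s'J that by fastforce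
    then show 2: "0 \<le> ((real b ^ 2 - 1) / (3 * real b)) ^ card p * (\<Prod>j\<in>p. real m - real (w j))"
      using b by (intro mult_nonneg_nonneg zero_le_power divide_nonneg_nonneg prod_nonneg) auto
    have "0 \<le> ?H p" by (intro mult_nonneg_nonneg) (auto simp: le_max_iff_disj)
    then show "0 \<le> ?T p" by (intro mult_nonneg_nonneg[OF _ add_nonneg_nonneg[OF _ 2]]) simp
  qed
  have \<gamma>_nonneg: "0 \<le> product_weights \<gamma> u" if "u \<subseteq> {1..s}" for u
    unfolding product_weights_def using that assms(11) by (intro prod_nonneg) (auto simp: less_imp_le)
  have F_nonneg: "0 \<le> ?F u" if "u \<subseteq> {1..s}" for u
    using that assms(11)
    by (intro mult_nonneg_nonneg prod_nonneg) (auto simp: less_imp_le subset_iff)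
  have MaxF: "?F u \<le> Max (?F ` ?U)" if "u \<in> ?U" for u
    using that finU by (intro Max_ge) auto
  have MaxG: "?G v \<le> Max (?G ` ?V)" if "v \<in> ?V" for v
    using that finU(2) by (intro Max_ge imageI) auto
  \<comment> \<open>Each \<open>u\<close> will be bounded by only one of the two maxima, so the
    other has to be nonnegative; the set \<open>{1}\<close> witnesses this for both.\<close>
  have F0: "0 \<le> Max (?F ` ?U)"
    using MaxF[of "{1}"] F_nonneg[of "{1}"] assms(3) by auto
  have G0: "0 \<le> Max (?G ` ?V)"
  proof -
    have "0 \<le> ?G {1}"
      by (intro mult_nonneg_nonneg \<gamma>_nonneg sum_nonneg T_nonneg(1)) (use s'J in auto)
    also have "\<dots> \<le> Max (?G ` ?V)" using s'J by (intro MaxG) auto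
    finally show ?thesis .
  qed
  have main: "product_weights \<gamma> u * \<bar>local_discr b m (digital_points b m Chat) u x\<bar>
      \<le> Max (?F ` ?U) + Max (?G ` ?V)"
    if x: "x \<in> {1..s} \<rightarrow>\<^sub>E {0<..1}" and u: "u \<in> ?U" for x u
  proof -
    let ?D = "local_discr b m (digital_points b m Chat) u x"
    have finu: "finite u" using u finite_subset by blast
    have xu: "\<forall>j\<in>u. 0 < x j \<and> x j \<le> 1" using x u by (fastforce dest: PiE_mem)
    have \<gamma>u: "0 \<le> product_weights \<gamma> u" using u by (intro \<gamma>_nonneg) auto
    show ?thesis
    proof (cases "u \<subseteq> {1..s'}")
      case True
      have "\<bar>?D\<bar> \<le> real b ^ t u / real b ^ m * ?H u"
        using assms(9) u xu b finu
        by (intro local_discr_net_bound) (auto simp: generates_digital_net_def)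
      also have "\<dots> \<le> ?T u"
        using T_nonneg(2)[OF True] by (intro mult_left_mono) auto
      \<comment> \<open>Only the term \<open>p = u\<close> is kept from a sum of nonnegative
        terms.\<close>
      also have "\<dots> \<le> (\<Sum>p | p \<noteq> {} \<and> p \<subseteq> u. ?T p)"
        using u True finu by (intro member_le_sum T_nonneg(1)) auto
      finally have "product_weights \<gamma> u * \<bar>?D\<bar> \<le> ?G u"
        using \<gamma>u by (rule mult_left_mono)
      also have "\<dots> \<le> Max (?G ` ?V)" using u True by (intro MaxG) auto
      finally show ?thesis using F0 by linarith
    next
      case False
      then obtain i where iu: "i \<in> u" and "i \<notin> {1..s'}" by blast
      moreover have "i \<in> {1..s}" using iu u by blast
      ultimately have i: "i \<in> u" "m \<le> w i" using V_iff[of i] by auto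
      \<comment> \<open>The factor of index \<open>i\<close> alone compensates 1/b^m and all other
        factors are at least 1, so the trivial bound 1 is enough.\<close>
      have "real b ^ m \<le> real b ^ w i" using i(2) b by (intro power_increasing) auto
      also have "\<dots> \<le> 1 + real b ^ w i" by simp
      also have "\<dots> \<le> (1 + real b ^ w i) * (\<Prod>j\<in>u - {i}. 1 + real b ^ w j)"
      proof -
        have "1 \<le> (\<Prod>j\<in>u - {i}. 1 + real b ^ w j)" by (intro prod_ge_1) simp
        then have "(1 + real b ^ w i) * 1 \<le> (1 + real b ^ w i) * (\<Prod>j\<in>u - {i}. 1 + real b ^ w j)"
          by (intro mult_left_mono) auto
        then show ?thesis by (simp only: mult_1_right)
      qed
      also have "\<dots> = (\<Prod>j\<in>u. 1 + real b ^ w j)"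
        using finu i by (intro prod.remove[symmetric])
      finally have "1 \<le> 1 / real b ^ m * (\<Prod>j\<in>u. 1 + real b ^ w j)"
        using b by (simp add: field_simps)
      with abs_local_discr_le_1[OF _ xu, of b m "digital_points b m Chat"]
      have "\<bar>?D\<bar> \<le> 1 / real b ^ m * (\<Prod>j\<in>u. 1 + real b ^ w j)"
        using b by linarith
      then have "product_weights \<gamma> u * \<bar>?D\<bar> \<le>
          product_weights \<gamma> u * (1 / real b ^ m * (\<Prod>j\<in>u. 1 + real b ^ w j))"
        using \<gamma>u by (rule mult_left_mono)
      also have "\<dots> = ?F u" by (simp add: product_weights_def prod.distrib)
      also have "\<dots> \<le> Max (?F ` ?U)" using u by (intro MaxF) auto
      finally show ?thesis using G0 by linarith
    qed
  qed
  have ne: "{1..s} \<rightarrow>\<^sub>E {0<..1::real} \<noteq> {}" by (simp add: PiE_eq_empty_iff)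
  show ?thesis
    unfolding weighted_star_discr_def
  proof (rule cSUP_least[OF ne])
    fix x assume x: "x \<in> {1..s} \<rightarrow>\<^sub>E {0<..1::real}"
    have "?U \<noteq> {}" using assms(3) by (auto intro!: exI[of _ "{1}"])
    then show "Max ((\<lambda>u. product_weights \<gamma> u * \<bar>local_discr b m (digital_points b m Chat) u x\<bar>) ` ?U)
        \<le> Max (?F ` ?U) + Max (?G ` ?V)"
      using finU(1) main[OF x] by (subst Max_le_iff) auto
  qed
qed

end
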